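(* Let $S=\{s_1,\dots,s_m\}\subset Q_R^n$ be given, where $Q_R^n$ is the cube in $\mathbb{R}^n$ with the edge $R$, such that for a certain $\epsilon>0$ we have $$M(\epsilon,S)>C(2N,n)\left(\frac{R}{\epsilon}\right)^{n-1}.$$ Then the generalized Prony system $$\sum_{j=1}^{N}a_j\,y_j^{s_\ell}=m_\ell,\qquad s_\ell\in S,\ \ell=1,\dots,m,$$ has at most one solution, where only real solutions $(a_j,y_j)$, $j=1,\dots,N$, with every $y_j\in\mathbb{R}^n$ having all its coordinates positive are considered.
   Context: For a bounded set $Z\subset\mathbb{R}^n$ and $\epsilon>0$, the covering number $M(\epsilon,Z)$ is the minimal number of $\epsilon$-balls in $\mathbb{R}^n$ covering $Z$. For $y=(y^1,\dots,y^n)$ with positive coordinates and $s=(s^1,\dots,s^n)\in\mathbb{R}^n$, $y^s=(y^1)^{s^1}\cdots(y^n)^{s^n}$. The numbers $m_\ell$ are the given right-hand sides of the system. The constant $C(d,n)$ depends only on $d$ and $n$ (it has a known explicit expression, obtained via Khovanskii's bound for fewnomial systems) and has the following property: for every real exponential polynomial $H(s)=\sum_{j=1}^d a_je^{\lambda_j\cdot s}$, $a_j\in\mathbb{R}$, $\lambda_j\in\mathbb{R}^n$, not identically zero, with zero set $Z(H)\subset\mathbb{R}^n$, and for each $R>0$ and $\epsilon$ with $R>\epsilon>0$, $$M(\epsilon,Z(H)\cap Q_R^n)\le C(d,n)\left(\frac{R}{\epsilon}\right)^{n-1}.$$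
   Formalization: Assumes ε<R (false for large ε when n≥2: a single point S would qualify). "At most one solution" means equal total coefficient at each node, and up to renumbering if all a_j≠0 and the y_j are distinct, since ordered tuples are never unique under renumbering or when a_j=0. *)

theory Defs
  imports "HOL-Analysis.Analysis"
begin

text \<open>Closed Euclidean balls, with centres anywhere in the ambient space. The definition is
  meaningful for bounded \<open>Z\<close>, where a finite cover exists.\<close>

definition covering_number :: "real \<Rightarrow> (real ^ 'n) set \<Rightarrow> nat" where
  "covering_number \<epsilon> Z =
     (LEAST k. \<exists>T. finite T \<and> card T = k \<and> Z \<subseteq> (\<Union>x\<in>T. cball x \<epsilon>))"

text \<open>The cube with edge \<open>R\<close>, with its position (lowest corner \<open>c\<close>) left as a parameter.\<close>

definition cube :: "real ^ 'n \<Rightarrow> real \<Rightarrow> (real ^ 'n) set" where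
  "cube c R = cbox c (\<chi> i. c $ i + R)"

definition mpow :: "real ^ 'n \<Rightarrow> real ^ 'n \<Rightarrow> real" where
  "mpow y s = (\<Prod>i\<in>UNIV. (y $ i) powr (s $ i))"

definition exp_poly :: "nat \<Rightarrow> (nat \<Rightarrow> real) \<Rightarrow> (nat \<Rightarrow> real ^ 'n) \<Rightarrow> real ^ 'n \<Rightarrow> real" where
  "exp_poly d a lam s = (\<Sum>j = 1..d. a j * exp (lam j \<bullet> s))"

definition zero_set :: "(real ^ 'n \<Rightarrow> real) \<Rightarrow> (real ^ 'n) set" where
  "zero_set H = {s. H s = 0}"

text \<open>\<open>C\<close> bounds the covering numbers of zero sets of exponential polynomials on \<open>\<real>\<^sup>n\<close>, where
  \<open>n = CARD('n)\<close> is fixed by the type of \<open>c\<close>; neither the coefficients nor the exponents enter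
  the bound.\<close>

definition zero_set_bound :: "(nat \<Rightarrow> nat \<Rightarrow> real) \<Rightarrow> real ^ 'n \<Rightarrow> bool" where
  "zero_set_bound C c \<longleftrightarrow>
     (\<forall>d a (lam :: nat \<Rightarrow> real ^ 'n) R \<epsilon>.
        (\<exists>s. exp_poly d a lam s \<noteq> 0) \<longrightarrow> 0 < \<epsilon> \<longrightarrow> \<epsilon> < R \<longrightarrow>
        real (covering_number \<epsilon> (zero_set (exp_poly d a lam) \<inter> cube c R))
          \<le> C d CARD('n) * (R / \<epsilon>) ^ (CARD('n) - 1))"

definition prony_solution ::
    "nat \<Rightarrow> nat \<Rightarrow> (nat \<Rightarrow> real ^ 'n) \<Rightarrow> (nat \<Rightarrow> real) \<Rightarrow> (nat \<Rightarrow> real) \<Rightarrow> (nat \<Rightarrow> real ^ 'n) \<Rightarrow> bool" where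
  "prony_solution N m s rhs a y \<longleftrightarrow>
     (\<forall>j\<in>{1..N}. \<forall>i. 0 < y j $ i) \<and>
     (\<forall>l\<in>{1..m}. (\<Sum>j = 1..N. a j * mpow (y j) (s l)) = rhs l)"

text \<open>A Prony system never determines the numbering of the nodes, nor the node of a term with zero
  coefficient, nor the splitting of a coefficient among coinciding nodes. Solutions are therefore
  identified when every node carries the same total coefficient in both, that is, when the atomic
  measures \<open>\<Sum>j. a j \<delta>(y j)\<close> agree.\<close>

definition same_solution ::
    "nat \<Rightarrow> (nat \<Rightarrow> real) \<Rightarrow> (nat \<Rightarrow> real ^ 'n) \<Rightarrow> (nat \<Rightarrow> real) \<Rightarrow> (nat \<Rightarrow> real ^ 'n) \<Rightarrow> bool" where
  "same_solution N a y a' y' \<longleftrightarrow>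
     (\<forall>z. (\<Sum>j \<in> {j \<in> {1..N}. y j = z}. a j) = (\<Sum>j \<in> {j \<in> {1..N}. y' j = z}. a' j))"

definition nondegenerate :: "nat \<Rightarrow> (nat \<Rightarrow> real) \<Rightarrow> (nat \<Rightarrow> real ^ 'n) \<Rightarrow> bool" where
  "nondegenerate N a y \<longleftrightarrow> (\<forall>j\<in>{1..N}. a j \<noteq> 0) \<and> inj_on y {1..N}"

end

theory Submission
  imports Defs
begin

text \<open>Two solutions of the system give an exponential polynomial with \<open>2 N\<close> terms and exponents the
  coordinatewise logarithms of the nodes, vanishing on the whole sample set. If it were not
  identically zero, its zero set would be too thin to contain the sample set; hence it vanishes
  identically, and linear independence of exponentials shows that the total coefficients at
  every node agree.\<close>

text \<open>An exponent \<open>w\<close> of maximal norm with nonzero coefficient would leave a term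
  that no other can cancel along the ray \<open>t *\<^sub>R w\<close> as \<open>t\<close> tends to
  infinity.\<close>

lemma exp_inner_independent:
  fixes g :: "'a::real_inner \<Rightarrow> real"
  assumes fin: "finite L" and zero: "\<And>s. (\<Sum>x\<in>L. g x * exp (x \<bullet> s)) = 0" and "z \<in> L"
  shows "g z = 0"
proof (rule ccontr)
  assume "g z \<noteq> 0"
  define M where "M = {x \<in> L. g x \<noteq> 0}"
  have M: "finite M" "M \<noteq> {}"
    using fin \<open>z \<in> L\<close> \<open>g z \<noteq> 0\<close> by (auto simp: M_def)
  have "Max (norm ` M) \<in> norm ` M"
    using M by (intro Max_in) auto
  then obtain w where w: "w \<in> M" and w_norm: "Max (norm ` M) = norm w"
    by blast
  have w_max: "norm x \<le> norm w" if "x \<in> M" for x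
    unfolding w_norm[symmetric] using M that by (intro Max_ge) auto
  \<comment> \<open>Along the ray through an exponent of maximal norm, its own term dominates.\<close>
  have neg: "x \<bullet> w - w \<bullet> w < 0" if "x \<in> M - {w}" for x
  proof -
    have "x \<bullet> x \<le> w \<bullet> w"
      using w_max[of x] that by (simp add: norm_le)
    \<comment> \<open>Expanding this strict inequality gives 2 (x . w) < x . x + w . w, which is at
      most 2 (w . w) by maximality.\<close>
    moreover have "0 < (w - x) \<bullet> (w - x)"
      using that by auto
    ultimately show ?thesis
      by (simp add: inner_diff_left inner_diff_right inner_commute)
  qed
  \<comment> \<open>The relation at \<open>s = t *\<^sub>R w\<close>, divided by the dominant factor
    \<open>exp (t * (w \<bullet> w))\<close>.\<close>
  have sum0: "(\<Sum>x\<in>M - {w}. g x * exp ((x \<bullet> w - w \<bullet> w) * t)) + g w = 0" for t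
  proof -
    have "0 = (\<Sum>x\<in>L. g x * exp (x \<bullet> (t *\<^sub>R w)))"
      by (rule zero[symmetric])
    also have "\<dots> = (\<Sum>x\<in>M. g x * exp (x \<bullet> (t *\<^sub>R w)))"
      unfolding M_def using fin by (intro sum.mono_neutral_right) auto
    also have "\<dots> = exp (t * (w \<bullet> w)) * (\<Sum>x\<in>M. g x * exp ((x \<bullet> w - w \<bullet> w) * t))"
      unfolding sum_distrib_left
      by (intro sum.cong refl) (simp add: mult.left_commute flip: exp_add, simp add: algebra_simps)
    also have "(\<Sum>x\<in>M. g x * exp ((x \<bullet> w - w \<bullet> w) * t)) =
        g w + (\<Sum>x\<in>M - {w}. g x * exp ((x \<bullet> w - w \<bullet> w) * t))"
      using M w by (simp add: sum.remove)
    finally show ?thesis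
      by simp
  qed
  have "((\<lambda>t. g x * exp ((x \<bullet> w - w \<bullet> w) * t)) \<longlongrightarrow> g x * 0) at_top" if "x \<in> M - {w}" for x
    by (rule tendsto_mult[OF tendsto_const filterlim_compose[OF exp_at_bot
          filterlim_tendsto_neg_mult_at_bot[OF tendsto_const neg[OF that] filterlim_ident]]])
  then have "((\<lambda>t. (\<Sum>x\<in>M - {w}. g x * exp ((x \<bullet> w - w \<bullet> w) * t)) + g w) \<longlongrightarrow>
      (\<Sum>x\<in>M - {w}. g x * 0) + g w) at_top"
    by (intro tendsto_add tendsto_sum tendsto_const)
  \<comment> \<open>By \<open>sum0\<close> the function is constantly 0, so its limit
    \<open>g w\<close> is 0.\<close>
  then have "g w = 0"
    unfolding sum0 by (simp add: tendsto_const_iff)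
  with w show False
    by (simp add: M_def)
qed

text \<open>Exponents may coincide here, so indices with equal \<open>lam j\<close> are grouped
  before independence of distinct exponents applies.\<close>

lemma exp_inner_family_independent:
  fixes lam :: "'i \<Rightarrow> 'a::real_inner"
  assumes "finite J" and zero: "\<And>s. (\<Sum>j\<in>J. b j * exp (lam j \<bullet> s)) = 0"
  shows "(\<Sum>j\<in>{j \<in> J. lam j = z}. b j) = 0"
proof (cases "z \<in> lam ` J")
  case True
  have "(\<Sum>x\<in>lam ` J. (\<Sum>j\<in>{j \<in> J. lam j = x}. b j) * exp (x \<bullet> s)) = 0" for s
  proof -
    have "(\<Sum>x\<in>lam ` J. (\<Sum>j\<in>{j \<in> J. lam j = x}. b j) * exp (x \<bullet> s)) =
        (\<Sum>x\<in>lam ` J. \<Sum>j\<in>{j \<in> J. lam j = x}. b j * exp (lam j \<bullet> s))"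
      by (simp add: sum_distrib_right)
    also have "\<dots> = 0"
      using assms by (subst sum.group) auto
    finally show ?thesis .
  qed
  then show ?thesis
    using exp_inner_independent[of "lam ` J" "\<lambda>x. \<Sum>j\<in>{j \<in> J. lam j = x}. b j"] assms(1) True
    by blast
next
  case False
  then have "{j \<in> J. lam j = z} = {}"
    by auto
  then show ?thesis
    by (simp only: sum.empty)
qed

text \<open>Boundedness of \<open>B\<close> provides a finite cover, so the \<open>LEAST\<close> for
  \<open>B\<close> is attained; an optimal cover of \<open>B\<close> also covers
  \<open>A\<close>.\<close>

lemma covering_number_mono:
  assumes "A \<subseteq> B" "bounded B" "0 < \<epsilon>"
  shows "covering_number \<epsilon> A \<le> covering_number \<epsilon> B"
proof -
  have "compact (closure B)"
    using assms(2) by (simp add: compact_closure)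
  then obtain T where T: "finite T" "closure B \<subseteq> (\<Union>x\<in>T. ball x \<epsilon>)"
    using assms(3) compact_eq_totally_bounded by metis
  have "B \<subseteq> (\<Union>x\<in>T. ball x \<epsilon>)"
    using closure_subset T(2) by (rule subset_trans)
  \<comment> \<open>Total boundedness yields open balls, whereas covering numbers count closed
    ones.\<close>
  also have "\<dots> \<subseteq> (\<Union>x\<in>T. cball x \<epsilon>)"
    by (intro UN_mono) auto
  finally have "B \<subseteq> (\<Union>x\<in>T. cball x \<epsilon>)" .
  with T(1) have "\<exists>k T. finite T \<and> card T = k \<and> B \<subseteq> (\<Union>x\<in>T. cball x \<epsilon>)"
    by blast
  then have "\<exists>T. finite T \<and> card T = covering_number \<epsilon> B \<and> B \<subseteq> (\<Union>x\<in>T. cball x \<epsilon>)"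
    unfolding covering_number_def by (rule LeastI_ex)
  with assms(1) have "\<exists>T. finite T \<and> card T = covering_number \<epsilon> B \<and> A \<subseteq> (\<Union>x\<in>T. cball x \<epsilon>)"
    by blast
  then show ?thesis
    unfolding covering_number_def[of \<epsilon> A] by (rule Least_le)
qed

lemma exp_poly_vanishes_if_covering_number_large:
  fixes c :: "real ^ 'n"
  assumes "zero_set_bound C c" "0 < \<epsilon>" "\<epsilon> < R" "S \<subseteq> cube c R"
    and large: "real (covering_number \<epsilon> S) > C d CARD('n) * (R / \<epsilon>) ^ (CARD('n) - 1)"
    and zero: "\<And>x. x \<in> S \<Longrightarrow> exp_poly d b lam x = 0"
  shows "exp_poly d b lam x = 0"
proof (rule ccontr)
  assume "exp_poly d b lam x \<noteq> 0"
  then have "real (covering_number \<epsilon> (zero_set (exp_poly d b lam) \<inter> cube c R))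
      \<le> C d CARD('n) * (R / \<epsilon>) ^ (CARD('n) - 1)"
    using assms(1-3) unfolding zero_set_bound_def by blast
  moreover have "covering_number \<epsilon> S \<le> covering_number \<epsilon> (zero_set (exp_poly d b lam) \<inter> cube c R)"
    using assms(2,4) zero
    by (intro covering_number_mono) (auto simp: zero_set_def cube_def bounded_Int)
  ultimately show False
    using large by linarith
qed

definition ln_vec :: "real ^ 'n \<Rightarrow> real ^ 'n" where
  "ln_vec y = (\<chi> i. ln (y $ i))"

lemma mpow_eq_exp_inner:
  assumes "\<And>i. 0 < y $ i"
  shows "mpow y s = exp (ln_vec y \<bullet> s)"
  unfolding mpow_def ln_vec_def inner_vec_def exp_sum[OF finite]
  \<comment> \<open>Positivity excludes base 0, where \<open>powr\<close> is 0 by convention and not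
    an exponential.\<close>
  using assms by (intro prod.cong) (auto simp: powr_def less_imp_neq[symmetric] mult.commute)

text \<open>Injectivity of \<open>ln\<close> on positive reals; it turns totals per exponent into
  totals per node.\<close>

lemma ln_vec_eq_iff:
  assumes "\<And>i. 0 < y $ i" "\<And>i. 0 < z $ i"
  shows "ln_vec y = ln_vec z \<longleftrightarrow> y = z"
  using assms by (simp add: ln_vec_def vec_eq_iff)

lemma sum_atLeastAtMost_double:
  fixes f :: "nat \<Rightarrow> 'a::comm_monoid_add"
  shows "(\<Sum>j=1..2*N. f j) = (\<Sum>j=1..N. f j) + (\<Sum>j=1..N. f (N + j))"
proof -
  have "(\<Sum>j=1..2*N. f j) = (\<Sum>j=1..N. f j) + (\<Sum>j=N+1..N+N. f j)"
    using sum.ub_add_nat[of 1 N f N] by (simp add: mult_2)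
  also have "(\<Sum>j=N+1..N+N. f j) = (\<Sum>j=1..N. f (N + j))"
    using sum.shift_bounds_cl_nat_ivl[of f 1 N N] by (simp add: add.commute)
  finally show ?thesis .
qed

lemma same_solution_if_covering_number_large:
  fixes c :: "real ^ 'n"
  assumes "zero_set_bound C c" "0 < \<epsilon>" "\<epsilon> < R" "s ` {1..m} \<subseteq> cube c R"
    and "real (covering_number \<epsilon> (s ` {1..m})) > C (2 * N) CARD('n) * (R / \<epsilon>) ^ (CARD('n) - 1)"
    and sol: "prony_solution N m s rhs a y" and sol': "prony_solution N m s rhs a' y'"
  shows "same_solution N a y a' y'"
proof -
  \<comment> \<open>Indices up to \<open>N\<close> carry the first solution, the next
    \<open>N\<close> the second with negated coefficients, so the polynomial is the difference of
    the two left-hand sides.\<close>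
  define b where "b j = (if j \<le> N then a j else - a' (j - N))" for j
  define lam where "lam j = (if j \<le> N then ln_vec (y j) else ln_vec (y' (j - N)))" for j
  have pos: "0 < y j $ i" "0 < y' j $ i" if "j \<in> {1..N}" for j i
    using sol sol' that unfolding prony_solution_def by blast+
  \<comment> \<open>Used twice: with \<open>P\<close> always true and \<open>h\<close> an
    exponential for the values of the polynomial, and with \<open>P\<close> selecting one exponent
    and \<open>h\<close> equal to 1 for total coefficients.\<close>
  have split: "(\<Sum>j=1..2*N. if P (lam j) then b j * h (lam j) else 0) =
      (\<Sum>j=1..N. if P (ln_vec (y j)) then a j * h (ln_vec (y j)) else 0) -
      (\<Sum>j=1..N. if P (ln_vec (y' j)) then a' j * h (ln_vec (y' j)) else 0)" for P h
    unfolding sum_atLeastAtMost_double diff_conv_add_uminus sum_negf[symmetric]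
    by (intro arg_cong2[where f = plus] sum.cong) (auto simp: b_def lam_def)
  have "exp_poly (2 * N) b lam x = 0" if "x \<in> s ` {1..m}" for x
  proof -
    from that obtain l where l: "l \<in> {1..m}" "x = s l"
      by blast
    have "exp_poly (2 * N) b lam x =
        (\<Sum>j=1..N. a j * exp (ln_vec (y j) \<bullet> x)) - (\<Sum>j=1..N. a' j * exp (ln_vec (y' j) \<bullet> x))"
      using split[of "\<lambda>_. True" "\<lambda>v. exp (v \<bullet> x)"] by (simp add: exp_poly_def)
    also have "\<dots> = (\<Sum>j=1..N. a j * mpow (y j) x) - (\<Sum>j=1..N. a' j * mpow (y' j) x)"
      using pos by (simp add: mpow_eq_exp_inner)
    also have "\<dots> = 0"
      using sol sol' l unfolding prony_solution_def by simp
    finally show ?thesis .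
  qed
  then have "exp_poly (2 * N) b lam x = 0" for x
    by (rule exp_poly_vanishes_if_covering_number_large[OF assms(1-5)])
  then have indep: "(\<Sum>j\<in>{j \<in> {1..2*N}. lam j = v}. b j) = 0" for v
    by (intro exp_inner_family_independent) (auto simp: exp_poly_def)
  have "(\<Sum>j\<in>{j \<in> {1..N}. y j = z}. a j) = (\<Sum>j\<in>{j \<in> {1..N}. y' j = z}. a' j)" for z
  \<comment> \<open>\<open>ln_vec\<close> separates only positive vectors; any other
    \<open>z\<close> is a node of neither solution.\<close>
  proof (cases "\<forall>i. 0 < z $ i")
    case True
    have "(\<Sum>j\<in>{j \<in> {1..N}. ln_vec (y j) = ln_vec z}. a j) =
        (\<Sum>j\<in>{j \<in> {1..N}. ln_vec (y' j) = ln_vec z}. a' j)"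
      using split[of "\<lambda>v. v = ln_vec z" "\<lambda>_. 1"] indep[of "ln_vec z"]
      unfolding sum.inter_filter[OF finite_atLeastAtMost] mult_1_right by linarith
    moreover have "{j \<in> {1..N}. ln_vec (y j) = ln_vec z} = {j \<in> {1..N}. y j = z}"
      "{j \<in> {1..N}. ln_vec (y' j) = ln_vec z} = {j \<in> {1..N}. y' j = z}"
      using pos True ln_vec_eq_iff by blast+
    ultimately show ?thesis
      by simp
  next
    case False
    then have "{j \<in> {1..N}. y j = z} = {}" "{j \<in> {1..N}. y' j = z} = {}"
      using pos by blast+
    then show ?thesis
      by (simp only: sum.empty)
  qed
  then show ?thesis
    unfolding same_solution_def by blast
qed

text \<open>The \<open>N\<close> distinct nodes of the first solution have nonzero totals, so all
  occur in the second; having only \<open>N\<close> indices, the second takes each node exactly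
  once.\<close>

lemma same_solution_imp_permutes:
  assumes same: "same_solution N a y a' y'" and nondeg: "nondegenerate N a y"
  shows "\<exists>\<pi>. \<pi> permutes {1..N} \<and> (\<forall>j\<in>{1..N}. a' j = a (\<pi> j) \<and> y' j = y (\<pi> j))"
proof -
  let ?I = "{1..N}"
  have inj: "inj_on y ?I" and nz: "\<And>j. j \<in> ?I \<Longrightarrow> a j \<noteq> 0"
    using nondeg by (auto simp: nondegenerate_def)
  have coeff: "a j = (\<Sum>k\<in>{k \<in> ?I. y' k = y j}. a' k)" if "j \<in> ?I" for j
  proof -
    have "{k \<in> ?I. y k = y j} = {j}"
      using inj that by (auto dest: inj_onD)
    then have "a j = (\<Sum>k\<in>{k \<in> ?I. y k = y j}. a k)"
      by simp
    then show ?thesis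
      using same unfolding same_solution_def by simp
  qed
  have sub: "y ` ?I \<subseteq> y' ` ?I"
  proof
    fix z assume "z \<in> y ` ?I"
    then obtain j where j: "j \<in> ?I" "z = y j"
      by blast
    \<comment> \<open>A nonzero total cannot be an empty sum.\<close>
    have "{k \<in> ?I. y' k = y j} \<noteq> {}"
      using coeff[OF j(1)] nz[OF j(1)] by (metis sum.empty)
    then show "z \<in> y' ` ?I"
      using j by force
  qed
  have card: "card (y ` ?I) = card ?I"
    using inj by (rule card_image)
  have eq: "y ` ?I = y' ` ?I"
    using sub card card_image_le[of ?I y'] by (intro card_seteq) auto
  have inj': "inj_on y' ?I"
    using card eq by (intro eq_card_imp_inj_on) auto
  \<comment> \<open>The identity outside the index set, as \<open>permutes\<close> demands.\<close>
  define \<pi> where "\<pi> j = (if j \<in> ?I then inv_into ?I y (y' j) else j)" for j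
  have \<pi>: "\<pi> j \<in> ?I" "y (\<pi> j) = y' j" if "j \<in> ?I" for j
  proof -
    have "y' j \<in> y ` ?I"
      using that eq by blast
    then show "\<pi> j \<in> ?I" "y (\<pi> j) = y' j"
      using that inv_into_into[of "y' j" y ?I] f_inv_into_f[of "y' j" y ?I]
      by (simp_all add: \<pi>_def)
  qed
  have "inj_on \<pi> ?I"
    using \<pi>(2) inj' by (metis inj_on_def)
  moreover have "\<pi> ` ?I \<subseteq> ?I"
    using \<pi>(1) by blast
  ultimately have "bij_betw \<pi> ?I ?I"
    by (simp add: bij_betw_def endo_inj_surj)
  then have "\<pi> permutes ?I"
    by (rule bij_imp_permutes) (simp only: \<pi>_def if_False)
  moreover have "a' j = a (\<pi> j)" if "j \<in> ?I" for j
  proof -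
    have "{k \<in> ?I. y' k = y (\<pi> j)} = {j}"
      using inj' that \<pi>(2)[OF that] by (auto dest: inj_onD)
    then show ?thesis
      using coeff[OF \<pi>(1)[OF that]] by simp
  qed
  ultimately show ?thesis
    using \<pi>(2) by metis
qed

text \<open>The second conjunct shows that for a nondegenerate solution the identification made by
  \<open>same_solution\<close> amounts to renumbering the terms.\<close>

theorem mainTheorem3:
  fixes C :: "nat \<Rightarrow> nat \<Rightarrow> real" and c :: "real ^ 'n" and R \<epsilon> :: real
    and N m :: nat and s :: "nat \<Rightarrow> real ^ 'n" and rhs :: "nat \<Rightarrow> real"
  assumes "zero_set_bound C c"
    and "0 < \<epsilon>" and "\<epsilon> < R"
    and "s ` {1..m} \<subseteq> cube c R"
    and "real (covering_number \<epsilon> (s ` {1..m})) > C (2 * N) CARD('n) * (R / \<epsilon>) ^ (CARD('n) - 1)"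
  shows "\<forall>a y a' y'. prony_solution N m s rhs a y \<longrightarrow> prony_solution N m s rhs a' y' \<longrightarrow>
           same_solution N a y a' y' \<and>
           (nondegenerate N a y \<longrightarrow>
             (\<exists>\<pi>. \<pi> permutes {1..N} \<and> (\<forall>j\<in>{1..N}. a' j = a (\<pi> j) \<and> y' j = y (\<pi> j))))"
  using same_solution_if_covering_number_large[OF assms] same_solution_imp_permutes by blast

end
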